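(* Let $0<N_0<D_0$ and $0<S_0\le S_{max}$. Suppose all available cash $N_0$ is used for an instantaneous partial repayment of the debt at time $0$, so that problem $(P)$ of the context is considered with initial state $N(0)=0$, $D(0)=D_0-N_0$, $S(0)=S_0$. Put $t_S=\frac1\alpha\ln\frac{\alpha S_0+w_{max}}{w_{max}}$, and let $$u^*(t)=\begin{cases}0,& t\in[0,t_S)\\ w_{max},& t\in[t_S,T]\end{cases},\qquad v^*(t)=\begin{cases}p w_{max}-K u^*(t)-B,& t\in[0,t_D)\\ A u^*(t),& t\in[t_D,T]\end{cases},\qquad w^*(t)\equiv w_{max},$$ where $t_D$ is the first moment at which the debt becomes zero, $D(t_D)=0$. Assume $t_S,t_D\in(0,T)$. Then $(u^*,v^*,w^* )$ is optimal for this problem.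
   Context: Problem $(P)$: given constants $T,p,r,A,K,B,\alpha,u_{max},v_{max},w_{max},S_{max}>0$ and a prescribed initial state $(N(0),D(0),S(0))$, maximize $$\mathcal J(u,v,w)=N(T)-D(T)$$ over piecewise continuous controls $(u,v,w)$ on $[0,T]$ with $0\le u(t)\le u_{max}$, $0\le v(t)\le v_{max}$, $0\le w(t)\le w_{max}$, subject to $$\dot N=p w-v-Ku-B,\qquad \dot D=rD+Au-v,\qquad \dot S=u-w-\alpha S,$$ and to the state constraints $N(t)\ge0$, $D(t)\ge0$, $0\le S(t)\le S_{max}$ for all $t\in[0,T]$. A control is optimal if it is admissible (satisfies all the constraints) and attains the maximum of $\mathcal J$ over all admissible controls. Standing assumptions: $w_{max}\le u_{max}$; $v_{max}$ is large enough that $v^*$ is an admissible repayment rate, i.e. $v_{max}\ge p w_{max}-B$; and the firm is profitable, i.e. $p w>Ku+B+Au$ along the strategy considered, which for $u=w=w_{max}$ reads $(p-A-K)w_{max}>B$. *)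

theory Defs
  imports "HOL-Analysis.Analysis"
begin

text \<open>Piecewise continuity in the usual sense: finitely many discontinuities in \<open>[a,b]\<close>, at each
  of which the one-sided limits taken from inside \<open>[a,b]\<close> exist and are finite.\<close>

definition piecewise_continuous :: "real \<Rightarrow> real \<Rightarrow> (real \<Rightarrow> real) \<Rightarrow> bool" where
  "piecewise_continuous a b f \<longleftrightarrow>
     (\<exists>X. finite X \<and> X \<subseteq> {a..b} \<and> continuous_on ({a..b} - X) f \<and>
          (\<forall>x\<in>X. (a < x \<longrightarrow> (\<exists>l. (f \<longlongrightarrow> l) (at_left x))) \<and>
                 (x < b \<longrightarrow> (\<exists>l. (f \<longlongrightarrow> l) (at_right x)))))"

text \<open>With piecewise continuous controls the right-hand side may jump, so a solution is a
  continuous function that satisfies the differential equation off a finite set.\<close>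

definition solves_ivp :: "real \<Rightarrow> (real \<Rightarrow> real \<Rightarrow> real) \<Rightarrow> real \<Rightarrow> (real \<Rightarrow> real) \<Rightarrow> bool" where
  "solves_ivp T f x0 x \<longleftrightarrow>
     x 0 = x0 \<and> continuous_on {0..T} x \<and>
     (\<exists>F. finite F \<and>
        (\<forall>t\<in>{0..T} - F. (x has_real_derivative f t (x t)) (at t within {0..T})))"

locale cash_debt_stock =
  fixes T p r A K B \<alpha> u_max v_max w_max S_max :: real
  assumes constants_pos:
    "T > 0" "p > 0" "r > 0" "A > 0" "K > 0" "B > 0" "\<alpha> > 0"
    "u_max > 0" "v_max > 0" "w_max > 0" "S_max > 0"
begin

definition state_trajectory ::
  "real \<Rightarrow> real \<Rightarrow> real \<Rightarrow> (real \<Rightarrow> real) \<Rightarrow> (real \<Rightarrow> real) \<Rightarrow> (real \<Rightarrow> real) \<Rightarrow>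
   (real \<Rightarrow> real) \<Rightarrow> (real \<Rightarrow> real) \<Rightarrow> (real \<Rightarrow> real) \<Rightarrow> bool" where
  "state_trajectory N_init D_init S_init u v w N D S \<longleftrightarrow>
     solves_ivp T (\<lambda>t x. p * w t - v t - K * u t - B) N_init N \<and>
     solves_ivp T (\<lambda>t x. r * x + A * u t - v t) D_init D \<and>
     solves_ivp T (\<lambda>t x. u t - w t - \<alpha> * x) S_init S"

definition admissible ::
  "real \<Rightarrow> real \<Rightarrow> real \<Rightarrow> (real \<Rightarrow> real) \<Rightarrow> (real \<Rightarrow> real) \<Rightarrow> (real \<Rightarrow> real) \<Rightarrow>
   (real \<Rightarrow> real) \<Rightarrow> (real \<Rightarrow> real) \<Rightarrow> (real \<Rightarrow> real) \<Rightarrow> bool" where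
  "admissible N_init D_init S_init u v w N D S \<longleftrightarrow>
     piecewise_continuous 0 T u \<and> piecewise_continuous 0 T v \<and> piecewise_continuous 0 T w \<and>
     (\<forall>t\<in>{0..T}. 0 \<le> u t \<and> u t \<le> u_max \<and> 0 \<le> v t \<and> v t \<le> v_max \<and> 0 \<le> w t \<and> w t \<le> w_max) \<and>
     state_trajectory N_init D_init S_init u v w N D S \<and>
     (\<forall>t\<in>{0..T}. 0 \<le> N t \<and> 0 \<le> D t \<and> 0 \<le> S t \<and> S t \<le> S_max)"

text \<open>The controls and the initial state determine the trajectory on \<open>[0,T]\<close>, so the objective
  \<open>N T - D T\<close> is a function of the controls although the trajectories are quantified here.\<close>

definition optimal ::
  "real \<Rightarrow> real \<Rightarrow> real \<Rightarrow> (real \<Rightarrow> real) \<Rightarrow> (real \<Rightarrow> real) \<Rightarrow> (real \<Rightarrow> real) \<Rightarrow> bool" where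
  "optimal N_init D_init S_init u v w \<longleftrightarrow>
     (\<exists>N D S. admissible N_init D_init S_init u v w N D S \<and>
        (\<forall>u' v' w' N' D' S'. admissible N_init D_init S_init u' v' w' N' D' S' \<longrightarrow>
           N' T - D' T \<le> N T - D T))"

end

end

theory Submission
  imports Defs
begin

text \<open>A Pontryagin-type verification argument.  With \<open>c = A + K\<close>, weight the cash balance by the
  shadow price \<open>\<lambda>(t) = exp(r max(t\<^sub>D - t, 0))\<close>, which is the debt growth factor for as long as debt remains,
  and the stock by the price \<open>\<mu>\<close> that equals \<open>c \<lambda>\<close> on \<open>[t\<^sub>S, T]\<close> and solves \<open>\<mu>' = \<alpha> \<mu>\<close> on \<open>[0, t\<^sub>S]\<close>.
  Along every admissible trajectory \<open>\<Psi> = \<lambda> (N - D) + \<mu> S\<close> grows at the rate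
  \<open>(p \<lambda> - \<mu>) w + (\<mu> - c \<lambda>) u - \<lambda> B + \<lambda>' N - (\<lambda>' + r \<lambda>) D + (\<mu>' - \<alpha> \<mu>) S\<close>, in which the signs
  of the prices make \<open>(p \<lambda> - \<mu>) w\<^sub>m\<^sub>a\<^sub>x - \<lambda> B\<close> an upper bound.  The candidate attains this bound at
  almost every time and ends with \<open>S(T) = 0\<close>, so it maximizes \<open>\<Psi>(T) - \<mu>(T) S(T) = N(T) - D(T)\<close>.\<close>

section \<open>Monotonicity and linear differential equations off a finite set\<close>

lemma antimono_off_finite:
  fixes f :: "real \<Rightarrow> real"
  assumes "a \<le> b" "continuous_on {a..b} f" "finite F"
    and deriv: "\<And>t. t \<in> {a<..<b} - F \<Longrightarrow> \<exists>d\<le>0. (f has_real_derivative d) (at t)"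
  shows "f b \<le> f a"
proof -
  \<comment> \<open>The derivative is picked by choice inside the interval and set to 0 elsewhere,
    so \<open>g\<close> is nonpositive everywhere. Its integral \<open>f b - f a\<close> is then
    nonpositive.\<close>
  define g where "g t = (if t \<in> {a<..<b} - F then SOME d. d \<le> 0 \<and> (f has_real_derivative d) (at t) else 0)" for t
  have g: "g t \<le> 0 \<and> (f has_real_derivative g t) (at t)" if "t \<in> {a<..<b} - F" for t
    using someI_ex[OF deriv[OF that, unfolded Bex_def]] that by (simp add: g_def)
  have "(g has_integral (f b - f a)) {a..b}"
    using assms(1-3) g
    by (intro fundamental_theorem_of_calculus_interior_strong[of F])
       (auto simp: has_real_derivative_iff_has_vector_derivative)
  moreover have "\<And>t. g t \<le> 0" using g by (metis g_def order_refl)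
  ultimately have "0 \<le> - (f b - f a)"
    using has_integral_nonneg[OF has_integral_neg, of g "f b - f a" "{a..b}"] by auto
  then show ?thesis by simp
qed

lemma const_off_finite:
  fixes f :: "real \<Rightarrow> real"
  assumes "a \<le> b" "continuous_on {a..b} f" "finite F"
    and "\<And>t. t \<in> {a<..<b} - F \<Longrightarrow> (f has_real_derivative 0) (at t)"
  shows "f b = f a"
proof (rule antisym)
  show "f b \<le> f a" using assms by (intro antimono_off_finite[of a b f F]) auto
  have "- f b \<le> - f a"
  proof (rule antimono_off_finite[of a b _ F])
    fix t assume "t \<in> {a<..<b} - F"
    then show "\<exists>d\<le>0. ((\<lambda>t. - f t) has_real_derivative d) (at t)"
      using assms(4) DERIV_minus[of f 0 t UNIV] by auto
  qed (use assms in \<open>auto intro: continuous_intros\<close>)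
  then show "f a \<le> f b" by simp
qed

text \<open>The integrating factor \<open>exp (- k * (t - a))\<close> turns \<open>x\<close> into a
  function with zero derivative off \<open>F\<close>.\<close>

lemma linear_ode_solution:
  fixes x :: "real \<Rightarrow> real"
  assumes "a \<le> b" "continuous_on {a..b} x" "finite F"
    and deriv: "\<And>t. t \<in> {a<..<b} - F \<Longrightarrow> (x has_real_derivative k * x t) (at t)"
    and t: "t \<in> {a..b}"
  shows "x t = x a * exp (k * (t - a))"
proof -
  have "x t * exp (- k * (t - a)) = x a * exp (- k * (a - a))"
  proof (rule const_off_finite[of a t _ F])
    show "continuous_on {a..t} (\<lambda>t. x t * exp (- k * (t - a)))"
      using t by (intro continuous_intros continuous_on_subset[OF assms(2)]) auto
    fix s assume "s \<in> {a<..<t} - F"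
    then have "(x has_real_derivative k * x s) (at s)" using t by (intro deriv) auto
    then show "((\<lambda>t. x t * exp (- k * (t - a))) has_real_derivative 0) (at s)"
      by (auto intro!: derivative_eq_intros simp: algebra_simps)
  qed (use assms in auto)
  then have "x t * exp (- k * (t - a)) * exp (k * (t - a)) = x a * exp (k * (t - a))" by simp
  then show ?thesis by (simp add: mult.assoc flip: exp_add)
qed

lemma solves_ivp_continuous: "solves_ivp T f x0 x \<Longrightarrow> continuous_on {0..T} x"
  by (simp add: solves_ivp_def)

text \<open>Restricting to interior points turns the derivative within \<open>{0..T}\<close> into a
  two-sided one.\<close>

lemma solves_ivp_deriv:
  assumes "solves_ivp T f x0 x"
  obtains F where "finite F"
    "\<And>t. t \<in> {0<..<T} - F \<Longrightarrow> (x has_real_derivative f t (x t)) (at t)"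
proof -
  from assms obtain F where F: "finite F"
    "\<forall>t\<in>{0..T} - F. (x has_real_derivative f t (x t)) (at t within {0..T})"
    by (auto simp: solves_ivp_def)
  show thesis
  proof (rule that[OF F(1)])
    fix t assume t: "t \<in> {0<..<T} - F"
    then have "(x has_real_derivative f t (x t)) (at t within {0..T})" using F(2) by auto
    moreover have "at t within {0..T} = at t" using t by (intro at_within_Icc_at) auto
    ultimately show "(x has_real_derivative f t (x t)) (at t)" by simp
  qed
qed

text \<open>The shift by \<open>q\<close> makes an affine equation homogeneous. The case
  \<open>k = 0\<close> covers states that stay constant.\<close>

lemma solves_ivp_linear:
  assumes "solves_ivp T f x0 x" "0 \<le> a" "b \<le> T"
    and rhs: "\<And>s y. a < s \<Longrightarrow> s < b \<Longrightarrow> f s y = k * (y + q)"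
    and t: "t \<in> {a..b}"
  shows "x t + q = (x a + q) * exp (k * (t - a))"
proof -
  obtain F where F: "finite F"
    "\<And>t. t \<in> {0<..<T} - F \<Longrightarrow> (x has_real_derivative f t (x t)) (at t)"
    using solves_ivp_deriv[OF assms(1)] by blast
  show ?thesis
  proof (rule linear_ode_solution[of a b "\<lambda>t. x t + q" F])
    show "continuous_on {a..b} (\<lambda>t. x t + q)"
      using assms(2,3)
      by (intro continuous_intros continuous_on_subset[OF solves_ivp_continuous[OF assms(1)]]) auto
    fix s assume s: "s \<in> {a<..<b} - F"
    then have "(x has_real_derivative k * (x s + q)) (at s)"
      using F(2)[of s] rhs[of s] assms(2,3) by auto
    then show "((\<lambda>t. x t + q) has_real_derivative k * (x s + q)) (at s)"
      by (auto intro!: derivative_eq_intros)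
  qed (use F t in auto)
qed

section \<open>Step functions as controls\<close>

lemma piecewise_continuous_right_continuous_step:
  fixes f :: "real \<Rightarrow> real"
  assumes "finite X" "X \<subseteq> {a..b}"
    and const: "\<And>s t. s \<le> t \<Longrightarrow> {s<..t} \<inter> X = {} \<Longrightarrow> f s = f t"
  shows "piecewise_continuous a b f"
  unfolding piecewise_continuous_def
proof (intro exI[of _ X] conjI ballI impI)
  have isolated: "\<exists>d>0. \<forall>y\<in>X. y \<noteq> x \<longrightarrow> d \<le> \<bar>x - y\<bar>" for x
    using finite_set_avoid[OF assms(1), of x] by (auto simp: dist_real_def)
  show "continuous_on ({a..b} - X) f"
  proof (rule continuous_at_imp_continuous_on, rule ballI)
    fix x assume x: "x \<in> {a..b} - X"
    obtain d where d: "d > 0" "\<forall>y\<in>X. y \<noteq> x \<longrightarrow> d \<le> \<bar>x - y\<bar>" using isolated by blast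
    have "f t = f x" if "dist t x < d" for t
    proof (cases "t \<le> x")
      case True
      then have "{t<..x} \<inter> X = {}" using that x d by (force simp: dist_real_def)
      then show ?thesis using const True by blast
    next
      case False
      then have "{x<..t} \<inter> X = {}" using that x d by (force simp: dist_real_def)
      then show ?thesis using const[of x t] False by simp
    qed
    then have "eventually (\<lambda>t. f t = f x) (nhds x)"
      unfolding eventually_nhds_metric using d(1) by blast
    then show "isCont f x" using isCont_cong[of f "\<lambda>_. f x" x] by simp
  qed
  fix x assume x: "x \<in> X"
  obtain d where d: "d > 0" "\<forall>y\<in>X. y \<noteq> x \<longrightarrow> d \<le> \<bar>x - y\<bar>" using isolated by blast
  have "eventually (\<lambda>t. f t = f x) (at_right x)"
    unfolding eventually_at_right_field
  proof (intro exI[of _ "x + d"] conjI allI impI)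
    fix t assume t: "x < t" "t < x + d"
    then have "{x<..t} \<inter> X = {}" using d by force
    then show "f t = f x" using const[of x t] t by simp
  qed (use d in auto)
  then show "\<exists>l. (f \<longlongrightarrow> l) (at_right x)" using tendsto_eventually by blast
  \<comment> \<open>Since \<open>f\<close> may jump at \<open>x\<close>, the left limit is read off
    at a point inside the gap of length \<open>d\<close> that separates \<open>x\<close> from the
    rest of \<open>X\<close>.\<close>
  have "eventually (\<lambda>t. f t = f (x - d / 2)) (at_left x)"
    unfolding eventually_at_left_field
  proof (intro exI[of _ "x - d / 2"] conjI allI impI)
    fix t assume t: "x - d / 2 < t" "t < x"
    then have "{x - d / 2<..t} \<inter> X = {}" using d by force
    then show "f t = f (x - d / 2)" using const[of "x - d / 2" t] t by simp
  qed (use d in auto)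
  then show "\<exists>l. (f \<longlongrightarrow> l) (at_left x)" using tendsto_eventually by blast
qed (use assms(1,2) in auto)

section \<open>Optimality from shadow prices\<close>

context cash_debt_stock
begin

text \<open>The repayment rate \<open>v\<close> cancels: it lowers cash and debt equally, and both
  carry the weight \<open>lam\<close>.\<close>

lemma shadow_value_deriv:
  assumes "(N has_real_derivative p * w - v - K * u - B) (at t)"
    and "(D has_real_derivative r * D t + A * u - v) (at t)"
    and "(S has_real_derivative u - w - \<alpha> * S t) (at t)"
    and "(lam has_real_derivative lam') (at t)" "(mu has_real_derivative mu') (at t)"
  shows "((\<lambda>t. lam t * (N t - D t) + mu t * S t) has_real_derivative
      (p * lam t - mu t) * w + (mu t - (A + K) * lam t) * u - lam t * B
      + lam' * N t - (lam' + r * lam t) * D t + (mu' - \<alpha> * mu t) * S t) (at t)"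
  by (rule derivative_eq_intros assms refl)+ (simp add: algebra_simps)

text \<open>The hypotheses on the prices are the adjoint inequalities with multipliers for the state
  constraints \<open>N \<ge> 0\<close>, \<open>D \<ge> 0\<close> and \<open>S \<ge> 0\<close>; those on the candidate are complementary slackness.\<close>

lemma optimal_if_shadow_prices:
  assumes adm: "admissible N_init D_init S_init u v w N D S"
    and cont: "continuous_on {0..T} lam" "continuous_on {0..T} mu"
    and fin: "finite F"
    and deriv: "\<And>t. t \<in> {0<..<T} - F \<Longrightarrow> (lam has_real_derivative lam' t) (at t)"
      "\<And>t. t \<in> {0<..<T} - F \<Longrightarrow> (mu has_real_derivative mu' t) (at t)"
    and adjoint: "\<And>t. t \<in> {0<..<T} - F \<Longrightarrow> lam' t \<le> 0"
      "\<And>t. t \<in> {0<..<T} - F \<Longrightarrow> 0 \<le> lam' t + r * lam t"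
      "\<And>t. t \<in> {0<..<T} - F \<Longrightarrow> mu' t \<le> \<alpha> * mu t"
    and switching: "\<And>t. t \<in> {0<..<T} - F \<Longrightarrow> mu t \<le> (A + K) * lam t"
      "\<And>t. t \<in> {0<..<T} - F \<Longrightarrow> mu t \<le> p * lam t"
    and slack: "\<And>t. t \<in> {0<..<T} - F \<Longrightarrow> w t = w_max"
      "\<And>t. t \<in> {0<..<T} - F \<Longrightarrow> (mu t - (A + K) * lam t) * u t = 0"
      "\<And>t. t \<in> {0<..<T} - F \<Longrightarrow> lam' t * N t = 0"
      "\<And>t. t \<in> {0<..<T} - F \<Longrightarrow> (lam' t + r * lam t) * D t = 0"
      "\<And>t. t \<in> {0<..<T} - F \<Longrightarrow> (mu' t - \<alpha> * mu t) * S t = 0"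
    and final: "lam T = 1" "0 \<le> mu T" "S T = 0"
  shows "optimal N_init D_init S_init u v w"
  unfolding optimal_def
proof (intro exI conjI allI impI)
  show "admissible N_init D_init S_init u v w N D S" by (fact adm)
  fix u' v' w' N' D' S' assume adm': "admissible N_init D_init S_init u' v' w' N' D' S'"
  define V where "V t = lam t * (N t - D t) + mu t * S t" for t
  define V' where "V' t = lam t * (N' t - D' t) + mu t * S' t" for t
  have ivp: "solves_ivp T (\<lambda>t x. p * w t - v t - K * u t - B) N_init N"
    "solves_ivp T (\<lambda>t x. r * x + A * u t - v t) D_init D"
    "solves_ivp T (\<lambda>t x. u t - w t - \<alpha> * x) S_init S"
    and ivp': "solves_ivp T (\<lambda>t x. p * w' t - v' t - K * u' t - B) N_init N'"
    "solves_ivp T (\<lambda>t x. r * x + A * u' t - v' t) D_init D'"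
    "solves_ivp T (\<lambda>t x. u' t - w' t - \<alpha> * x) S_init S'"
    using adm adm' by (auto simp: admissible_def state_trajectory_def)
  obtain F1 where F1: "finite F1" "\<And>t. t \<in> {0<..<T} - F1 \<Longrightarrow>
      (N has_real_derivative p * w t - v t - K * u t - B) (at t)"
    using solves_ivp_deriv[OF ivp(1)] by blast
  obtain F2 where F2: "finite F2" "\<And>t. t \<in> {0<..<T} - F2 \<Longrightarrow>
      (D has_real_derivative r * D t + A * u t - v t) (at t)"
    using solves_ivp_deriv[OF ivp(2)] by blast
  obtain F3 where F3: "finite F3" "\<And>t. t \<in> {0<..<T} - F3 \<Longrightarrow>
      (S has_real_derivative u t - w t - \<alpha> * S t) (at t)"
    using solves_ivp_deriv[OF ivp(3)] by blast
  obtain G1 where G1: "finite G1" "\<And>t. t \<in> {0<..<T} - G1 \<Longrightarrow>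
      (N' has_real_derivative p * w' t - v' t - K * u' t - B) (at t)"
    using solves_ivp_deriv[OF ivp'(1)] by blast
  obtain G2 where G2: "finite G2" "\<And>t. t \<in> {0<..<T} - G2 \<Longrightarrow>
      (D' has_real_derivative r * D' t + A * u' t - v' t) (at t)"
    using solves_ivp_deriv[OF ivp'(2)] by blast
  obtain G3 where G3: "finite G3" "\<And>t. t \<in> {0<..<T} - G3 \<Longrightarrow>
      (S' has_real_derivative u' t - w' t - \<alpha> * S' t) (at t)"
    using solves_ivp_deriv[OF ivp'(3)] by blast
  \<comment> \<open>Working with the difference of the two values avoids integrating the common
    upper bound of their rates.\<close>
  have "V' T - V T \<le> V' 0 - V 0"
  proof (rule antimono_off_finite[where f = "\<lambda>t. V' t - V t" and F = "F \<union> F1 \<union> F2 \<union> F3 \<union> G1 \<union> G2 \<union> G3"])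
    show "continuous_on {0..T} (\<lambda>t. V' t - V t)"
      unfolding V_def V'_def using cont ivp ivp'
      by (intro continuous_intros) (auto dest: solves_ivp_continuous)
    fix t assume t: "t \<in> {0<..<T} - (F \<union> F1 \<union> F2 \<union> F3 \<union> G1 \<union> G2 \<union> G3)"
    let ?rate = "\<lambda>u w N D S. (p * lam t - mu t) * w + (mu t - (A + K) * lam t) * u - lam t * B
      + lam' t * N - (lam' t + r * lam t) * D + (mu' t - \<alpha> * mu t) * S"
    have tF: "t \<in> {0<..<T} - F" using t by auto
    \<comment> \<open>The rate no longer mentions the repayment, so \<open>v t\<close> has to be
      supplied by hand.\<close>
    have "(V has_real_derivative ?rate (u t) (w t) (N t) (D t) (S t)) (at t)"
      unfolding V_def using t by (intro shadow_value_deriv[where v = "v t"] F1 F2 F3 deriv) auto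
    moreover have "(V' has_real_derivative ?rate (u' t) (w' t) (N' t) (D' t) (S' t)) (at t)"
      unfolding V'_def using t by (intro shadow_value_deriv[where v = "v' t"] G1 G2 G3 deriv) auto
    ultimately have "((\<lambda>t. V' t - V t) has_real_derivative
        ?rate (u' t) (w' t) (N' t) (D' t) (S' t) - ?rate (u t) (w t) (N t) (D t) (S t)) (at t)"
      by (intro DERIV_diff)
    moreover have "?rate (u' t) (w' t) (N' t) (D' t) (S' t) \<le> (p * lam t - mu t) * w_max - lam t * B"
    proof -
      have b: "0 \<le> u' t" "w' t \<le> w_max" "0 \<le> N' t" "0 \<le> D' t" "0 \<le> S' t"
        using adm' t by (auto simp: admissible_def)
      have "(p * lam t - mu t) * w' t \<le> (p * lam t - mu t) * w_max"
        using switching(2)[OF tF] b by (intro mult_left_mono) auto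
      moreover have "(mu t - (A + K) * lam t) * u' t \<le> 0"
        using switching(1)[OF tF] b by (intro mult_nonpos_nonneg) auto
      moreover have "lam' t * N' t \<le> 0"
        using adjoint(1)[OF tF] b by (intro mult_nonpos_nonneg) auto
      moreover have "0 \<le> (lam' t + r * lam t) * D' t"
        using adjoint(2)[OF tF] b by (intro mult_nonneg_nonneg) auto
      moreover have "(mu' t - \<alpha> * mu t) * S' t \<le> 0"
        using adjoint(3)[OF tF] b by (intro mult_nonpos_nonneg) auto
      ultimately show ?thesis by linarith
    qed
    moreover have "?rate (u t) (w t) (N t) (D t) (S t) = (p * lam t - mu t) * w_max - lam t * B"
      by (simp only: slack[OF tF])
    ultimately show "\<exists>d\<le>0. ((\<lambda>t. V' t - V t) has_real_derivative d) (at t)"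
      by (intro exI conjI[rotated]) (assumption, linarith)
  qed (use constants_pos fin F1(1) F2(1) F3(1) G1(1) G2(1) G3(1) in auto)
  moreover have "V' 0 = V 0"
    using ivp ivp' by (simp add: V_def V'_def solves_ivp_def)
  \<comment> \<open>Stock left over by a competitor has nonnegative shadow value, so dropping it
    from \<open>V' T\<close> only favours the competitor's bound:
    \<open>N' T - D' T \<le> V' T\<close>.\<close>
  moreover have "0 \<le> mu T * S' T"
    using adm' final(2) constants_pos(1) by (auto simp: admissible_def)
  ultimately show "N' T - D' T \<le> N T - D T"
    using final by (simp add: V_def V'_def)
qed

end

text \<open>\<open>D_init\<close> stands for the debt \<open>D\<^sub>0 - N\<^sub>0\<close> left after the instantaneous repayment.\<close>

locale repayment_strategy = cash_debt_stock +
  fixes D_init S0 tS tD :: real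
    and u_star v_star w_star N D S :: "real \<Rightarrow> real"
  assumes w_max_le: "w_max \<le> u_max"
    and v_max_ge: "p * w_max - B \<le> v_max"
    and profitable: "B < (p - A - K) * w_max"
    and D_init_pos: "0 < D_init"
    and S0_bounds: "0 < S0" "S0 \<le> S_max"
    and tS_eq: "tS = 1 / \<alpha> * ln ((\<alpha> * S0 + w_max) / w_max)"
    and u_def: "u_star = (\<lambda>t. if t < tS then 0 else w_max)"
    and v_def: "v_star = (\<lambda>t. if t < tD then p * w_max - K * u_star t - B else A * u_star t)"
    and w_def: "w_star = (\<lambda>t. w_max)"
    and trajectory: "state_trajectory 0 D_init S0 u_star v_star w_star N D S"
    and D_tD: "D tD = 0" and D_nonzero: "\<forall>t\<in>{0..<tD}. D t \<noteq> 0"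
    and switching_times: "0 < tS" "tS < T" "0 < tD" "tD < T"
begin

section \<open>The candidate trajectory and its admissibility\<close>

lemma ivp:
  "solves_ivp T (\<lambda>t x. p * w_star t - v_star t - K * u_star t - B) 0 N"
  "solves_ivp T (\<lambda>t x. r * x + A * u_star t - v_star t) D_init D"
  "solves_ivp T (\<lambda>t x. u_star t - w_star t - \<alpha> * x) S0 S"
  using trajectory by (auto simp: state_trajectory_def)

lemma initial_values: "N 0 = 0" "D 0 = D_init" "S 0 = S0"
  using ivp by (auto simp: solves_ivp_def)

lemma margins_pos: "p * w_max - K * w_max - A * w_max - B > 0"
  using profitable by (simp add: algebra_simps)

lemma cost_pos: "A * w_max > 0" "K * w_max > 0"
  using constants_pos by auto

lemma unit_cost_less_price: "A + K < p"
proof -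
  have "0 < (p - A - K) * w_max" using profitable constants_pos by linarith
  then show ?thesis using constants_pos by (simp add: zero_less_mult_iff)
qed

text \<open>Before \<open>tD\<close> the whole net cash flow goes into repayment, so cash has rate
  zero.\<close>

lemma N_eq_0_until_tD: "N t = 0" if "t \<in> {0..tD}"
  using solves_ivp_linear[OF ivp(1), of 0 tD 0 0 t] that initial_values switching_times(4)
  by (simp add: v_def w_def)

text \<open>From \<open>tD\<close> on repayment matches the new borrowing
  \<open>A * u_star t\<close>, which leaves the equation of pure interest growth, started at
  zero.\<close>

lemma D_eq_0_from_tD: "D t = 0" if "t \<in> {tD..T}"
  using solves_ivp_linear[OF ivp(2), of tD T r 0 t] that D_tD switching_times(3)
  by (simp add: v_def)

lemma S_until_tS: "S t = (S0 + w_max / \<alpha>) * exp (- \<alpha> * t) - w_max / \<alpha>" if "t \<in> {0..tS}"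
proof -
  have "S t + w_max / \<alpha> = (S 0 + w_max / \<alpha>) * exp (- \<alpha> * (t - 0))"
    using that switching_times(2) constants_pos(7)
    by (intro solves_ivp_linear[OF ivp(3), of 0 tS]) (auto simp: u_def w_def algebra_simps)
  then show ?thesis using initial_values by simp
qed

text \<open>This is the equation for the stock to run out, solved by the logarithm in
  \<open>tS_eq\<close>.\<close>

lemma exp_tS: "(S0 + w_max / \<alpha>) * exp (- \<alpha> * tS) = w_max / \<alpha>"
proof -
  have "(\<alpha> * S0 + w_max) / w_max > 0" using constants_pos S0_bounds(1) by (simp add: add_pos_pos)
  then have "exp (\<alpha> * tS) = (\<alpha> * S0 + w_max) / w_max" using constants_pos(7) by (simp add: tS_eq)
  moreover have "\<alpha> * S0 + w_max > 0" using constants_pos S0_bounds(1) by (simp add: add_pos_pos)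
  ultimately show ?thesis using constants_pos by (simp add: exp_minus field_simps)
qed

lemma S_tS: "S tS = 0"
  using S_until_tS[of tS] exp_tS switching_times(1) by simp

lemma S_eq_0_from_tS: "S t = 0" if "t \<in> {tS..T}"
  using solves_ivp_linear[OF ivp(3), of tS T "-\<alpha>" 0 t] that switching_times(1) S_tS
  by (simp add: u_def w_def)

text \<open>Up to \<open>tS\<close> the closed form decreases from \<open>S0\<close> to 0;
  afterwards purchases equal sales and the stock stays at 0.\<close>

lemma S_bounds: "0 \<le> S t \<and> S t \<le> S_max" if "t \<in> {0..T}"
proof (cases "t \<le> tS")
  case True
  have c: "0 \<le> S0 + w_max / \<alpha>" using constants_pos S0_bounds(1) by simp
  have "(S0 + w_max / \<alpha>) * exp (- \<alpha> * tS) \<le> (S0 + w_max / \<alpha>) * exp (- \<alpha> * t)"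
    using True constants_pos c by (intro mult_left_mono) auto
  moreover have "(S0 + w_max / \<alpha>) * exp (- \<alpha> * t) \<le> (S0 + w_max / \<alpha>) * 1"
    using that constants_pos c by (intro mult_left_mono) auto
  ultimately show ?thesis using S_until_tS[of t] True that exp_tS S0_bounds(2) by auto
next
  case False
  then show ?thesis using S_eq_0_from_tS[of t] that constants_pos by auto
qed

text \<open>Debt starts positive, so a negative value before \<open>tD\<close> would force an
  earlier zero, against the choice of \<open>tD\<close> as the first one.\<close>

lemma D_nonneg: "0 \<le> D t" if t: "t \<in> {0..T}"
proof (cases "t < tD")
  case True
  show ?thesis
  proof (rule ccontr)
    assume "\<not> 0 \<le> D t"
    moreover have "continuous_on {0..t} D"
      using t by (intro continuous_on_subset[OF solves_ivp_continuous[OF ivp(2)]]) auto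
    ultimately obtain s where "0 \<le> s" "s \<le> t" "D s = 0"
      using IVT2'[of D t 0 0] t initial_values D_init_pos by auto
    then show False using D_nonzero True by auto
  qed
qed (use D_eq_0_from_tD t in auto)

text \<open>After \<open>tD\<close> cash grows at rate at least
  \<open>p * w_max - K * w_max - A * w_max - B\<close>, which profitability makes positive.\<close>

lemma N_nonneg: "0 \<le> N t" if t: "t \<in> {0..T}"
proof (cases "t \<le> tD")
  case False
  obtain F where F: "finite F" "\<And>t. t \<in> {0<..<T} - F \<Longrightarrow>
      (N has_real_derivative p * w_star t - v_star t - K * u_star t - B) (at t)"
    using solves_ivp_deriv[OF ivp(1)] by blast
  have "- N t \<le> - N tD"
  proof (rule antimono_off_finite[of tD t _ F])
    show "continuous_on {tD..t} (\<lambda>t. - N t)"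
      using t switching_times(3)
      by (intro continuous_intros continuous_on_subset[OF solves_ivp_continuous[OF ivp(1)]]) auto
    fix s assume s: "s \<in> {tD<..<t} - F"
    then have "((\<lambda>t. - N t) has_real_derivative
        - (p * w_star s - v_star s - K * u_star s - B)) (at s)"
      using t switching_times(3) by (intro DERIV_minus F) auto
    moreover have "- (p * w_star s - v_star s - K * u_star s - B) \<le> 0"
      using s margins_pos cost_pos by (cases "s < tS") (simp_all add: u_def v_def w_def)
    ultimately show "\<exists>d\<le>0. ((\<lambda>t. - N t) has_real_derivative d) (at s)" by blast
  qed (use False F in auto)
  then show ?thesis using N_eq_0_until_tD[of tD] switching_times(3) by simp
qed (use N_eq_0_until_tD t in auto)

lemma piecewise_continuous_step_at_switches: "piecewise_continuous 0 T f"
  if "\<And>s t. s \<le> t \<Longrightarrow> {s<..t} \<inter> {tS, tD} = {} \<Longrightarrow> f s = f t" for f :: "real \<Rightarrow> real"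
  using that switching_times by (intro piecewise_continuous_right_continuous_step[of "{tS, tD}"]) auto

lemma admissible_strategy: "admissible 0 (D_init) S0 u_star v_star w_star N D S"
  unfolding admissible_def
proof (intro conjI)
  show "piecewise_continuous 0 T u_star" by (rule piecewise_continuous_step_at_switches) (auto simp: u_def)
  show "piecewise_continuous 0 T v_star" by (rule piecewise_continuous_step_at_switches) (auto simp: u_def v_def)
  show "piecewise_continuous 0 T w_star" by (rule piecewise_continuous_step_at_switches) (auto simp: w_def)
  show "\<forall>t\<in>{0..T}. 0 \<le> u_star t \<and> u_star t \<le> u_max \<and> 0 \<le> v_star t \<and> v_star t \<le> v_max \<and>
      0 \<le> w_star t \<and> w_star t \<le> w_max"
  proof -
    \<comment> \<open>Profitability also bounds the late repayment: \<open>A * w_max\<close> lies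
      below \<open>p * w_max - K * w_max - B\<close>, hence below \<open>v_max\<close>.\<close>
    have "B \<le> p * w_max" "B + K * w_max \<le> p * w_max" "p * w_max - K * w_max - B \<le> v_max"
      "0 \<le> A * w_max" "A * w_max \<le> v_max"
      using v_max_ge margins_pos cost_pos by linarith+
    then show ?thesis using constants_pos w_max_le v_max_ge by (auto simp: u_def v_def w_def)
  qed
qed (use trajectory S_bounds D_nonneg N_nonneg in auto)

section \<open>The shadow prices\<close>

definition lam :: "real \<Rightarrow> real" where
  "lam t = exp (r * max (tD - t) 0)"

text \<open>The value at \<open>tD\<close>, where \<open>lam\<close> has a kink, is arbitrary:
  \<open>lam_deriv\<close> excludes that point.\<close>

definition lam' :: "real \<Rightarrow> real" where
  "lam' t = (if t < tD then - r * lam t else 0)"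

text \<open>The two maxima merge the branches before and after \<open>tS\<close> into one
  expression, whose continuity is then immediate.\<close>

definition mu :: "real \<Rightarrow> real" where
  "mu t = (A + K) * lam (max t tS) * exp (- \<alpha> * max (tS - t) 0)"

definition mu' :: "real \<Rightarrow> real" where
  "mu' t = (if t < tS then \<alpha> * mu t else (A + K) * lam' t)"

lemma lam_pos: "lam t > 0"
  by (simp add: lam_def)

lemma lam_antimono: "lam t \<le> lam s" if "s \<le> t"
  using that constants_pos by (auto simp: lam_def)

lemma mu_from_tS: "mu t = (A + K) * lam t" if "tS \<le> t"
  using that by (simp add: mu_def max_def)

text \<open>Before \<open>tS\<close> both factors can only lose: \<open>lam\<close> is evaluated at
  a later time, where it is no larger, and the exponential is at most 1.\<close>

lemma mu_le: "mu t \<le> (A + K) * lam t"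
proof -
  have "lam (max t tS) * exp (- \<alpha> * max (tS - t) 0) \<le> lam t * 1"
    using constants_pos lam_pos[of t] lam_antimono by (intro mult_mono) auto
  then show ?thesis using constants_pos by (simp add: mu_def mult.assoc)
qed

lemma lam_deriv: "(lam has_real_derivative lam' t) (at t)" if "t \<noteq> tD"
proof (cases "t < tD")
  case True
  have "((\<lambda>t. exp (r * (tD - t))) has_real_derivative lam' t) (at t)"
    using True by (auto intro!: derivative_eq_intros simp: lam'_def lam_def)
  then show ?thesis
    by (rule has_field_derivative_transform_within_open[of _ _ _ "{..<tD}"])
       (use True in \<open>auto simp: lam_def\<close>)
next
  case False
  have "((\<lambda>t. 1) has_real_derivative lam' t) (at t)"
    using False by (simp add: lam'_def)
  then show ?thesis
    by (rule has_field_derivative_transform_within_open[of _ _ _ "{tD<..}"])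
       (use False that in \<open>auto simp: lam_def\<close>)
qed

lemma mu_deriv: "(mu has_real_derivative mu' t) (at t)" if "t \<noteq> tD" "t \<noteq> tS"
proof (cases "t < tS")
  case True
  have "((\<lambda>t. (A + K) * lam tS * exp (- \<alpha> * (tS - t))) has_real_derivative mu' t) (at t)"
    using True by (auto intro!: derivative_eq_intros simp: mu'_def mu_def max_def)
  then show ?thesis
    by (rule has_field_derivative_transform_within_open[of _ _ _ "{..<tS}"])
       (use True in \<open>auto simp: mu_def max_def\<close>)
next
  case False
  have "((\<lambda>t. (A + K) * lam t) has_real_derivative mu' t) (at t)"
    using False that lam_deriv[of t] by (auto intro!: derivative_eq_intros simp: mu'_def)
  then show ?thesis
    by (rule has_field_derivative_transform_within_open[of _ _ _ "{tS<..}"])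
       (use False that in \<open>auto simp: mu_from_tS\<close>)
qed

lemma optimal_strategy: "optimal 0 D_init S0 u_star v_star w_star"
proof (rule optimal_if_shadow_prices[OF admissible_strategy, where F = "{tS, tD}" and lam = lam and mu = mu
      and lam' = lam' and mu' = mu'])
  show "continuous_on {0..T} lam" "continuous_on {0..T} mu"
    unfolding mu_def lam_def by (intro continuous_intros)+
  fix t assume t: "t \<in> {0<..<T} - {tS, tD}"
  show "lam' t \<le> 0" "0 \<le> lam' t + r * lam t"
    using constants_pos(3) lam_pos[of t] by (auto simp: lam'_def)
  show "mu' t \<le> \<alpha> * mu t"
  proof (cases "t < tS")
    case False
    \<comment> \<open>After \<open>tS\<close> the price \<open>mu\<close> is proportional to
      \<open>lam\<close>, hence nonincreasing, while \<open>\<alpha> * mu t\<close> is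
      nonnegative.\<close>
    have "(A + K) * lam' t \<le> 0" "0 \<le> \<alpha> * ((A + K) * lam t)"
      using constants_pos lam_pos[of t] by (auto simp: lam'_def mult_nonneg_nonpos)
    then show ?thesis using False by (simp add: mu'_def mu_from_tS)
  qed (simp add: mu'_def)
  show "mu t \<le> p * lam t"
  proof (rule order_trans[OF mu_le])
    show "(A + K) * lam t \<le> p * lam t" using unit_cost_less_price lam_pos[of t] by (intro mult_right_mono) auto
  qed
  show "(mu t - (A + K) * lam t) * u_star t = 0"
    by (simp add: u_def mu_from_tS)
  \<comment> \<open>Each multiplier vanishes where its state constraint is slack:
    \<open>lam'\<close> from \<open>tD\<close> on, \<open>lam' + r * lam\<close> before
    \<open>tD\<close>, and \<open>mu' - \<alpha> * mu\<close> before \<open>tS\<close>.\<close>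
  show "lam' t * N t = 0" using N_eq_0_until_tD[of t] t by (simp add: lam'_def)
  show "(lam' t + r * lam t) * D t = 0" using D_eq_0_from_tD[of t] t by (simp add: lam'_def)
  show "(mu' t - \<alpha> * mu t) * S t = 0" using S_eq_0_from_tS[of t] t by (simp add: mu'_def)
next
  show "lam T = 1" using switching_times(4) by (simp add: lam_def)
  show "0 \<le> mu T" using constants_pos lam_pos by (simp add: mu_def less_imp_le)
  show "S T = 0" using S_eq_0_from_tS[of T] switching_times(2) by simp
qed (use lam_deriv mu_deriv mu_le w_def in auto)

end

theorem mainTheorem5:
  fixes T p r A K B \<alpha> u_max v_max w_max S_max :: real
    and N0 D0 S0 tS tD :: real
    and u_star v_star w_star N D S :: "real \<Rightarrow> real"
  assumes "cash_debt_stock T p r A K B \<alpha> u_max v_max w_max S_max"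
    and "w_max \<le> u_max"
    and "v_max \<ge> p * w_max - B"
    and "(p - A - K) * w_max > B"
    and "0 < N0" "N0 < D0"
    and "0 < S0" "S0 \<le> S_max"
    and "tS = 1 / \<alpha> * ln ((\<alpha> * S0 + w_max) / w_max)"
    and "u_star = (\<lambda>t. if t < tS then 0 else w_max)"
    and "v_star = (\<lambda>t. if t < tD then p * w_max - K * u_star t - B else A * u_star t)"
    and "w_star = (\<lambda>t. w_max)"
    and "cash_debt_stock.state_trajectory T p r A K B \<alpha> 0 (D0 - N0) S0 u_star v_star w_star N D S"
    and "D tD = 0" "\<forall>t\<in>{0..<tD}. D t \<noteq> 0"
    and "0 < tS" "tS < T" "0 < tD" "tD < T"
  shows "cash_debt_stock.optimal T p r A K B \<alpha> u_max v_max w_max S_max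
           0 (D0 - N0) S0 u_star v_star w_star"
proof -
  interpret repayment_strategy T p r A K B \<alpha> u_max v_max w_max S_max "D0 - N0" S0 tS tD
      u_star v_star w_star N D S
    using assms by (auto intro!: repayment_strategy.intro repayment_strategy_axioms.intro)
  show ?thesis by (fact optimal_strategy)
qed

end
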